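(* For any continuous function $H:[0,1]\to\mathbb{R}$, $$\lim_{N\to\infty}\mathbb{E}_{\mu^N_{ss}}\Big[\,\Big|\langle\pi^N,H\rangle-\gamma\int_0^1H(x)\,dx\Big|\,\Big]=0.$$
   Context: Fix $0<\alpha,\beta<1$ and set $\gamma=(\alpha+\beta)/2$. For $N\ge 3$ let $\Sigma_N=\{1,\dots,N-1\}$, $\Omega_N=\{0,1\}^{\Sigma_N}$, $r_1=\alpha$, $r_{N-1}=\beta$. For $f:\Omega_N\to\mathbb{R}$ define $(\mathcal{L}_{N,0}f)(\eta)=\sum_{x=1}^{N-2}(f(\eta^{x,x+1})-f(\eta))$ and $(\mathcal{L}_{N,b}f)(\eta)=\sum_{x\in\{1,N-1\}}[r_x(1-\eta(x))+(1-r_x)\eta(x)](f(\eta^x)-f(\eta))$, where $\eta^{x,x+1}$ is obtained from $\eta$ by exchanging the values at $x$ and $x+1$, and $\eta^x$ by replacing $\eta(x)$ with $1-\eta(x)$. The Markov process on $\Omega_N$ with generator $\mathcal{L}_N=N^2\mathcal{L}_{N,0}+\mathcal{L}_{N,b}$ is irreducible on a finite state space; $\mu^N_{ss}$ denotes its unique stationary probability measure (which is also that of the process with generator $N\mathcal{L}_N$), and $\mathbb{E}_{\mu^N_{ss}}$ is the expectation when the configuration $\eta$ has law $\mu^N_{ss}$. For $\eta\in\Omega_N$, $\pi^N=\frac1N\sum_{x=1}^{N-1}\eta(x)\delta_{x/N}$ and $\langle\pi^N,H\rangle=\frac1N\sum_{x=1}^{N-1}\eta(x)H(x/N)$. *)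

theory Defs
  imports "HOL-Probability.Probability"
begin

definition sites :: "nat \<Rightarrow> nat set" where
  "sites N = {1..N - 1}"

text \<open>Configurations are extensional functions, so that distinct elements of this set
  differ at some site and the set is finite.\<close>

definition configs :: "nat \<Rightarrow> (nat \<Rightarrow> nat) set" where
  "configs N = sites N \<rightarrow>\<^sub>E {0, 1}"

definition exchange :: "nat \<Rightarrow> nat \<Rightarrow> (nat \<Rightarrow> nat) \<Rightarrow> nat \<Rightarrow> nat" where
  "exchange x y \<eta> = \<eta>(x := \<eta> y, y := \<eta> x)"

definition flip :: "nat \<Rightarrow> (nat \<Rightarrow> nat) \<Rightarrow> nat \<Rightarrow> nat" where
  "flip x \<eta> = \<eta>(x := 1 - \<eta> x)"

text \<open>Only the values at the two boundary sites \<open>1\<close> and \<open>N - 1\<close> are used.\<close>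

definition reservoir :: "real \<Rightarrow> real \<Rightarrow> nat \<Rightarrow> real" where
  "reservoir \<alpha> \<beta> x = (if x = 1 then \<alpha> else \<beta>)"

definition bulk_gen :: "nat \<Rightarrow> ((nat \<Rightarrow> nat) \<Rightarrow> real) \<Rightarrow> (nat \<Rightarrow> nat) \<Rightarrow> real" where
  "bulk_gen N f \<eta> = (\<Sum>x = 1..N - 2. f (exchange x (x + 1) \<eta>) - f \<eta>)"

definition boundary_gen ::
    "real \<Rightarrow> real \<Rightarrow> nat \<Rightarrow> ((nat \<Rightarrow> nat) \<Rightarrow> real) \<Rightarrow> (nat \<Rightarrow> nat) \<Rightarrow> real" where
  "boundary_gen \<alpha> \<beta> N f \<eta> =
    (\<Sum>x\<in>{1, N - 1}.
      (reservoir \<alpha> \<beta> x * (1 - real (\<eta> x)) + (1 - reservoir \<alpha> \<beta> x) * real (\<eta> x))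
        * (f (flip x \<eta>) - f \<eta>))"

definition gen ::
    "real \<Rightarrow> real \<Rightarrow> nat \<Rightarrow> ((nat \<Rightarrow> nat) \<Rightarrow> real) \<Rightarrow> (nat \<Rightarrow> nat) \<Rightarrow> real" where
  "gen \<alpha> \<beta> N f \<eta> = (real N)\<^sup>2 * bulk_gen N f \<eta> + boundary_gen \<alpha> \<beta> N f \<eta>"

text \<open>The Markov semigroup \<open>exp (t L)\<close> of the process with generator \<open>L\<close>. On \<open>configs N\<close>, with
  \<open>L = gen \<alpha> \<beta> N\<close> and \<open>N \<ge> 3\<close>, the series converges for every \<open>f\<close>: the state space is finite
  and closed under the jumps, so \<open>L\<close> acts as a matrix.\<close>

definition semigroup_of ::
    "(('s \<Rightarrow> real) \<Rightarrow> 's \<Rightarrow> real) \<Rightarrow> real \<Rightarrow> ('s \<Rightarrow> real) \<Rightarrow> 's \<Rightarrow> real" where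
  "semigroup_of L t f \<eta> = (\<Sum>k. t ^ k / fact k * (L ^^ k) f \<eta>)"

definition stationary :: "real \<Rightarrow> real \<Rightarrow> nat \<Rightarrow> (nat \<Rightarrow> nat) pmf \<Rightarrow> bool" where
  "stationary \<alpha> \<beta> N \<mu> \<longleftrightarrow>
    set_pmf \<mu> \<subseteq> configs N \<and>
    (\<forall>t\<ge>0. \<forall>f. measure_pmf.expectation \<mu> (semigroup_of (gen \<alpha> \<beta> N) t f)
      = measure_pmf.expectation \<mu> f)"

text \<open>Well defined for \<open>0 < \<alpha> < 1\<close>, \<open>0 < \<beta> < 1\<close> and \<open>N \<ge> 3\<close>, where the process is
  irreducible on a finite state space.\<close>

definition mu_ss :: "real \<Rightarrow> real \<Rightarrow> nat \<Rightarrow> (nat \<Rightarrow> nat) pmf" where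
  "mu_ss \<alpha> \<beta> N = (THE \<mu>. stationary \<alpha> \<beta> N \<mu>)"

text \<open>The integral of \<open>H\<close> against the empirical measure of \<open>\<eta>\<close>, which puts mass \<open>\<eta> x / N\<close>
  at \<open>x / N\<close>.\<close>

definition empirical :: "nat \<Rightarrow> (nat \<Rightarrow> nat) \<Rightarrow> (real \<Rightarrow> real) \<Rightarrow> real" where
  "empirical N \<eta> H = 1 / real N * (\<Sum>x\<in>sites N. real (\<eta> x) * H (real x / real N))"

end

theory Submission imports Defs begin

text \<open>Let \<open>\<gamma>\<close> be the mean reservoir density and let \<open>E\<close> denote the stationary expectation. Since
  \<open>E (L f) = 0\<close> for all \<open>f\<close>, the centred occupation variables \<open>\<eta> x - \<gamma>\<close> have a mean that is affine
  in \<open>x\<close> with slope \<open>O (1 / N\<^sup>2)\<close>, hence of order \<open>1 / N\<close>. Their two-point function solves a discrete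
  elliptic equation on pairs of distinct sites whose source sits at the boundary and is \<open>O (1 / N)\<close>
  because it contains the mean as a factor; by the maximum principle it is \<open>O (1 / N)\<close> as well. So
  the second moment of \<open>1 / N * (\<Sum>x. (\<eta> x - \<gamma>) * H (x / N))\<close> is \<open>O (1 / N)\<close>, and what remains is
  the convergence of Riemann sums.\<close>

section \<open>Riemann sums of a continuous function on the unit interval\<close>

lemma riemann_sum_tendsto_integral:
  fixes H :: "real \<Rightarrow> real"
  assumes H: "continuous_on {0..1} H"
  shows "(\<lambda>N. 1 / real N * (\<Sum>x<N. H (real x / real N))) \<longlonglongrightarrow> integral {0..1} H"
proof (rule LIMSEQ_I)
  fix e :: real assume "0 < e"
  have "uniformly_continuous_on {0..1} H"
    using H compact_uniformly_continuous by blast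
  then obtain d where "0 < d"
    and d: "\<And>x y. x \<in> {0..1} \<Longrightarrow> y \<in> {0..1} \<Longrightarrow> dist y x < d \<Longrightarrow> dist (H y) (H x) < e / 2"
    using \<open>0 < e\<close> unfolding uniformly_continuous_on_def by (meson half_gt_zero)
  obtain M :: nat where M: "1 / d < real M" using reals_Archimedean2 by blast
  have "norm (1 / real N * (\<Sum>x<N. H (real x / real N)) - integral {0..1} H) < e" if "M \<le> N" for N
  proof -
    have N: "0 < real N" "1 / real N < d"
    proof -
      have "1 / d < real N" using M that by linarith
      moreover have "0 < 1 / d" using \<open>0 < d\<close> by simp
      ultimately show "0 < real N" by linarith
      with \<open>1 / d < real N\<close> \<open>0 < d\<close> show "1 / real N < d" by (simp add: field_simps)
    qed
    have int: "H integrable_on {a..b}" if "0 \<le> a" "b \<le> 1" for a b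
      using continuous_on_subset[OF H] that by (intro integrable_continuous_real) auto
    \<comment> \<open>Induction over the cells: on each one \<open>H\<close> stays within
      \<open>e / 2\<close> of its value at the left endpoint, so the error up to
      \<open>k / N\<close> is at most \<open>e / 2\<close> times the length covered.\<close>
    have "\<bar>integral {0..real k / real N} H - 1 / real N * (\<Sum>x<k. H (real x / real N))\<bar>
        \<le> e / 2 * (real k / real N)" if "k \<le> N" for k
      using that
    proof (induction k)
      case (Suc k)
      define a b where "a = real k / real N" and "b = real (Suc k) / real N"
      have ab: "0 \<le> a" "a \<le> b" "b \<le> 1" "b - a = 1 / real N"
        using N Suc.prems by (auto simp: a_def b_def field_simps)
      have split: "integral {0..b} H = integral {0..a} H + integral {a..b} H"
        using Henstock_Kurzweil_Integration.integral_combine[where f = H and a = 0 and c = a and b = b] ab int[of 0 b] by simp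
      have "((\<lambda>t. H t - H a) has_integral (integral {a..b} H - (b - a) * H a)) {a..b}"
        using has_integral_diff[OF integrable_integral[OF int] has_integral_const_real[of "H a" a b]] ab
        by simp
      moreover have "\<bar>H t - H a\<bar> \<le> e / 2" if "t \<in> {a..b}" for t
        using d[of a t] that ab N by (auto simp: dist_real_def)
      ultimately have "\<bar>integral {a..b} H - (b - a) * H a\<bar> \<le> e / 2 * (b - a)"
        using has_integral_bound_real[of "e / 2" "{}" "\<lambda>t. H t - H a" _ a b] \<open>0 < e\<close> ab by simp
      moreover have "\<bar>integral {0..a} H - 1 / real N * (\<Sum>x<k. H (real x / real N))\<bar> \<le> e / 2 * a"
        using Suc by (simp add: a_def)
      moreover have "1 / real N * (\<Sum>x<Suc k. H (real x / real N))
          = 1 / real N * (\<Sum>x<k. H (real x / real N)) + (b - a) * H a"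
        unfolding ab(4) by (simp add: a_def distrib_left)
      moreover have "e / 2 * b = e / 2 * a + e / 2 * (b - a)" by (simp add: field_simps)
      ultimately show ?case
        unfolding b_def[symmetric] split by linarith
    qed simp
    from this[of N] show ?thesis using N \<open>0 < e\<close> by (auto simp: abs_minus_commute)
  qed
  then show "\<exists>M. \<forall>N\<ge>M. norm (1 / real N * (\<Sum>x<N. H (real x / real N)) - integral {0..1} H) < e"
    by blast
qed

subsection \<open>Stationary weights of finite jump processes\<close>

text \<open>Eliminating a state \<open>s\<close>, i.e. watching the chain only while it is outside \<open>s\<close>, gives rates
  on the smaller set whose balanced weights extend to \<open>s\<close>.\<close>

lemma balanced_weights_exist:
  fixes q :: "'s \<Rightarrow> 's \<Rightarrow> real"
  assumes "finite S" "S \<noteq> {}" "\<And>x y. x \<in> S \<Longrightarrow> y \<in> S \<Longrightarrow> 0 \<le> q x y"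
  shows "\<exists>v. (\<forall>x\<in>S. 0 \<le> v x) \<and> 0 < sum v S \<and>
    (\<forall>y\<in>S. (\<Sum>x\<in>S. v x * q x y) = v y * (\<Sum>x\<in>S. q y x))"
  using assms
proof (induction S arbitrary: q rule: finite_ne_induct)
  case (singleton s)
  show ?case by (rule exI[of _ "\<lambda>_. 1"]) simp
next
  case (insert s S)
  define Q where "Q = (\<Sum>y\<in>S. q s y)"
  have Q0: "0 \<le> Q" unfolding Q_def using insert.prems by (intro sum_nonneg) auto
  show ?case
  proof (cases "Q = 0")
    \<comment> \<open>No state of \<open>S\<close> can be entered from \<open>s\<close>: it is
      absorbing, and the point mass at \<open>s\<close> is balanced.\<close>
    case True
    then have "q s y = 0" if "y \<in> S" for y
      using that insert.prems insert.hyps unfolding Q_def by (subst (asm) sum_nonneg_eq_0_iff) auto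
    with insert.hyps show ?thesis
      by (intro exI[of _ "\<lambda>x. if x = s then 1 else 0"]) (auto intro!: sum.neutral sum_nonneg add_pos_nonneg)
  next
    case False
    with Q0 have Q: "0 < Q" by simp
    \<comment> \<open>To the direct rate this adds the rate of entering \<open>s\<close> from
      \<open>x\<close>, times the probability \<open>q s y / Q\<close> that the exit from
      \<open>s\<close> leads to \<open>y\<close>.\<close>
    define q' where "q' x y = q x y + q x s * q s y / Q" for x y
    have "0 \<le> q' x y" if "x \<in> S" "y \<in> S" for x y
      using insert.prems that Q unfolding q'_def by simp
    from insert.IH[of q', OF this] obtain v where
      v: "\<forall>x\<in>S. 0 \<le> v x" "0 < sum v S"
        "\<forall>y\<in>S. (\<Sum>x\<in>S. v x * q' x y) = v y * (\<Sum>x\<in>S. q' y x)"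
      by blast
    \<comment> \<open>This value equates the flow from \<open>S\<close> into \<open>s\<close> with
      the flow \<open>c * Q\<close> back; the diagonal rate \<open>q s s\<close> occurs on both
      sides of the balance and cancels.\<close>
    define c where "c = (\<Sum>x\<in>S. v x * q x s) / Q"
    define w where "w = v(s := c)"
    have ws [simp]: "w s = c" by (simp add: w_def)
    have wS [simp]: "w x = v x" if "x \<in> S" for x
      using insert.hyps that by (auto simp: w_def)
    have sumS: "(\<Sum>x\<in>S. w x * f x) = (\<Sum>x\<in>S. v x * f x)" for f by (rule sum.cong) auto
    have c0: "0 \<le> c" unfolding c_def using Q v insert.prems by (intro divide_nonneg_pos sum_nonneg) auto
    have bal_s: "(\<Sum>x\<in>insert s S. w x * q x s) = w s * (\<Sum>x\<in>insert s S. q s x)"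
      using insert.hyps Q by (simp add: sumS Q_def[symmetric] c_def field_simps)
    have bal: "(\<Sum>x\<in>insert s S. w x * q x y) = w y * (\<Sum>x\<in>insert s S. q y x)" if y: "y \<in> S" for y
    proof -
      have "(\<Sum>x\<in>S. v x * q' x y) = (\<Sum>x\<in>S. v x * q x y) + c * q s y"
        by (simp add: q'_def c_def algebra_simps sum.distrib sum_divide_distrib sum_distrib_left)
      moreover have "(\<Sum>x\<in>S. q' y x) = (\<Sum>x\<in>S. q y x) + q y s"
      proof -
        have "(\<Sum>x\<in>S. q y s * q s x / Q) = q y s * Q / Q"
          by (simp add: Q_def sum_divide_distrib sum_distrib_left)
        then show ?thesis using Q by (simp add: q'_def sum.distrib)
      qed
      ultimately show ?thesis using v(3) y insert.hyps by (simp add: sumS algebra_simps)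
    qed
    have "sum w S = sum v S" by (rule sum.cong) auto
    then show ?thesis using insert.hyps bal bal_s v c0
      by (intro exI[of _ w]) auto
  qed
qed

lemma pmf_of_weights_exists:
  assumes "finite S" "\<And>x. x \<in> S \<Longrightarrow> 0 \<le> v x" "sum v S = (1::real)"
  shows "\<exists>p. set_pmf p \<subseteq> S \<and> (\<forall>x\<in>S. pmf p x = v x)"
proof -
  define w where "w x = (if x \<in> S then v x else 0)" for x
  have w0: "0 \<le> w x" for x using assms by (simp add: w_def)
  have "(\<integral>\<^sup>+x. ennreal (w x) \<partial>count_space UNIV) = (\<Sum>x\<in>S. ennreal (w x))"
    using assms by (intro nn_integral_count_space'[of S]) (auto simp: w_def)
  also have "\<dots> = ennreal (sum w S)" using w0 by simp
  also have "sum w S = 1" using assms by (simp add: w_def)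
  finally have w1: "(\<integral>\<^sup>+x. ennreal (w x) \<partial>count_space UNIV) = 1" by simp
  show ?thesis
    using w0 w1 by (intro exI[of _ "embed_pmf w"]) (auto simp: set_embed_pmf pmf_embed_pmf w_def)
qed

text \<open>Diagonal rates \<open>q x x\<close> may be positive, since they cancel in
  \<open>L_eq\<close>; exchanging two equal occupations produces such rates. On \<open>S\<close>,
  \<open>L f\<close> depends only on the values of \<open>f\<close> on \<open>S\<close>, so
  \<open>L\<close> can be iterated there like a matrix.\<close>

locale jump_process =
  fixes S :: "'s set" and q :: "'s \<Rightarrow> 's \<Rightarrow> real" and L :: "('s \<Rightarrow> real) \<Rightarrow> 's \<Rightarrow> real"
  assumes finite_S: "finite S"
    and q_nonneg: "x \<in> S \<Longrightarrow> y \<in> S \<Longrightarrow> 0 \<le> q x y"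
    and L_eq: "x \<in> S \<Longrightarrow> L f x = (\<Sum>y\<in>S. q x y * (f y - f x))"
begin

text \<open>Infinitesimal invariance: as a row vector, \<open>v\<close> is in the left kernel of
  \<open>L\<close>. The weights may be signed, so that differences of stationary weights are
  covered.\<close>

definition annihilates :: "('s \<Rightarrow> real) \<Rightarrow> bool" where
  "annihilates v \<longleftrightarrow> (\<forall>f. (\<Sum>x\<in>S. v x * L f x) = 0)"

text \<open>Passes to the adjoint: the factor next to \<open>f y\<close> is the net flow of
  \<open>v\<close> into \<open>y\<close>.\<close>

lemma sum_L_eq:
  "(\<Sum>x\<in>S. v x * L f x) = (\<Sum>y\<in>S. f y * ((\<Sum>x\<in>S. v x * q x y) - v y * (\<Sum>x\<in>S. q y x)))"
proof -
  have "(\<Sum>x\<in>S. v x * L f x) = (\<Sum>x\<in>S. \<Sum>y\<in>S. f y * (v x * q x y) - f x * (v x * q x y))"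
    by (intro sum.cong) (auto simp: L_eq sum_distrib_left algebra_simps)
  also have "\<dots> = (\<Sum>y\<in>S. \<Sum>x\<in>S. f y * (v x * q x y)) - (\<Sum>x\<in>S. \<Sum>y\<in>S. f x * (v x * q x y))"
    unfolding sum_subtractf by (subst sum.swap) simp
  finally show ?thesis
    by (simp add: sum_distrib_left sum_subtractf right_diff_distrib)
qed

lemma annihilates_iff_balance:
  "annihilates v \<longleftrightarrow> (\<forall>y\<in>S. (\<Sum>x\<in>S. v x * q x y) = v y * (\<Sum>x\<in>S. q y x))"
proof
  assume v: "annihilates v"
  show "\<forall>y\<in>S. (\<Sum>x\<in>S. v x * q x y) = v y * (\<Sum>x\<in>S. q y x)"
  proof
    fix y assume y: "y \<in> S"
    have "(\<Sum>z\<in>S. of_bool (z = y) * ((\<Sum>x\<in>S. v x * q x z) - v z * (\<Sum>x\<in>S. q z x))) = 0"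
      using v unfolding annihilates_def sum_L_eq by (rule spec)
    moreover have "(\<Sum>z\<in>S. of_bool (z = y) * ((\<Sum>x\<in>S. v x * q x z) - v z * (\<Sum>x\<in>S. q z x)))
        = (\<Sum>z\<in>S. if z = y then (\<Sum>x\<in>S. v x * q x z) - v z * (\<Sum>x\<in>S. q z x) else 0)"
      by (intro sum.cong) auto
    ultimately show "(\<Sum>x\<in>S. v x * q x y) = v y * (\<Sum>x\<in>S. q y x)"
      using y finite_S by simp
  qed
qed (simp add: annihilates_def sum_L_eq)

lemma annihilates_diff:
  "annihilates v \<Longrightarrow> annihilates w \<Longrightarrow> annihilates (\<lambda>x. v x - w x)"
  by (simp add: annihilates_def left_diff_distrib sum_subtractf)

text \<open>At every state the outflow of the positive part is at most its inflow. Summed over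
  \<open>S\<close> the two agree, so they agree state by state.\<close>

lemma positive_part_balance:
  assumes "annihilates v" "y \<in> S"
  shows "(\<Sum>x\<in>S. max (v x) 0 * q x y) = max (v y) 0 * (\<Sum>x\<in>S. q y x)"
proof -
  let ?p = "\<lambda>x. max (v x) 0"
  have le: "?p z * (\<Sum>x\<in>S. q z x) \<le> (\<Sum>x\<in>S. ?p x * q x z)" if z: "z \<in> S" for z
  proof (cases "0 < v z")
    case True
    have "v z * (\<Sum>x\<in>S. q z x) = (\<Sum>x\<in>S. v x * q x z)"
      using assms(1) z unfolding annihilates_iff_balance by simp
    also have "\<dots> \<le> (\<Sum>x\<in>S. ?p x * q x z)"
      using q_nonneg z by (intro sum_mono mult_right_mono) auto
    finally show ?thesis using True by simp
  next
    case False
    then have "?p z = 0" by simp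
    then show ?thesis using q_nonneg z by (auto intro!: sum_nonneg)
  qed
  have "(\<Sum>z\<in>S. ?p z * (\<Sum>x\<in>S. q z x)) = (\<Sum>z\<in>S. \<Sum>x\<in>S. ?p x * q x z)"
    by (subst sum.swap) (simp add: sum_distrib_left)
  then have "(\<Sum>z\<in>S. (\<Sum>x\<in>S. ?p x * q x z) - ?p z * (\<Sum>x\<in>S. q z x)) = 0"
    by (simp add: sum_subtractf)
  then have "\<forall>z\<in>S. (\<Sum>x\<in>S. ?p x * q x z) - ?p z * (\<Sum>x\<in>S. q z x) = 0"
    by (subst (asm) sum_nonneg_eq_0_iff) (use le finite_S in auto)
  then show ?thesis using assms(2) by simp
qed

text \<open>Where the positive part vanishes, its balanced inflow is a vanishing sum of nonnegative
  terms, so no state of positive weight jumps there.\<close>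

lemma positive_support_closed:
  assumes "annihilates v" "x \<in> S" "y \<in> S" "0 < v x" "0 < q x y"
  shows "0 < v y"
proof (rule ccontr)
  assume "\<not> 0 < v y"
  then have "(\<Sum>z\<in>S. max (v z) 0 * q z y) = 0"
    using positive_part_balance[OF assms(1,3)] by (simp add: max_def)
  then have "\<forall>z\<in>S. max (v z) 0 * q z y = 0"
    by (subst (asm) sum_nonneg_eq_0_iff) (use assms q_nonneg finite_S in auto)
  then show False using assms by (auto simp: max_def)
qed

text \<open>The positive and negative parts of the difference of two stationary weights have disjoint
  supports, both of which would contain \<open>r\<close>.\<close>

lemma annihilates_unique:
  assumes "annihilates v" "annihilates w" "sum v S = sum w S"
    and reach: "\<And>Z. Z \<subseteq> S \<Longrightarrow> Z \<noteq> {} \<Longrightarrow>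
      (\<And>x y. x \<in> Z \<Longrightarrow> y \<in> S \<Longrightarrow> 0 < q x y \<Longrightarrow> y \<in> Z) \<Longrightarrow> r \<in> Z"
    and "x \<in> S"
  shows "v x = w x"
proof -
  have pos: "0 < u r" if u: "annihilates u" "y \<in> S" "0 < u y" for u y
  proof -
    have "r \<in> {y \<in> S. 0 < u y}"
    proof (rule reach)
      show "{y \<in> S. 0 < u y} \<noteq> {}" using u by blast
      show "z \<in> {y \<in> S. 0 < u y}" if "x \<in> {y \<in> S. 0 < u y}" "z \<in> S" "0 < q x z" for x z
        using positive_support_closed[OF u(1), of x z] that by simp
    qed simp
    then show ?thesis by simp
  qed
  \<comment> \<open>If \<open>b - a\<close> were positive anywhere, \<open>pos\<close> would make it
    positive at \<open>r\<close>, against \<open>b r <= a r\<close>. Hence \<open>a - b\<close> is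
    nonnegative, and having total zero it vanishes.\<close>
  have *: "a x = b x" if ab: "annihilates a" "annihilates b" "sum a S = sum b S" "b r \<le> a r" for a b
  proof -
    have "b y - a y \<le> 0" if y: "y \<in> S" for y
    proof (rule ccontr)
      assume "\<not> b y - a y \<le> 0"
      then have "0 < b r - a r" using pos[OF annihilates_diff[OF ab(2,1)] y] by simp
      then show False using ab(4) by simp
    qed
    moreover have "(\<Sum>y\<in>S. a y - b y) = 0" using ab(3) by (simp add: sum_subtractf)
    ultimately have "\<forall>y\<in>S. a y - b y = 0"
      using sum_nonneg_eq_0_iff[OF finite_S, of "\<lambda>y. a y - b y"] by simp
    then show ?thesis using \<open>x \<in> S\<close> by simp
  qed
  show ?thesis
  proof (cases "w r \<le> v r")
    case True
    show ?thesis by (rule *[OF assms(1-3) True])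
  next
    case False
    then have "v r \<le> w r" by simp
    from *[OF assms(2,1) assms(3)[symmetric] this] show ?thesis by (rule sym)
  qed
qed

section \<open>Invariance under the semigroup and under its generator\<close>

lemma iterate_bound:
  obtains K M where "0 \<le> K" "\<And>k x. x \<in> S \<Longrightarrow> \<bar>(L ^^ k) f x\<bar> \<le> K ^ k * M"
proof -
  \<comment> \<open>Twice the total rate bounds the norm of \<open>L\<close> for the supremum norm
    over \<open>S\<close>.\<close>
  define K where "K = 2 * (\<Sum>x\<in>S. \<Sum>y\<in>S. q x y)"
  define M where "M = (\<Sum>x\<in>S. \<bar>f x\<bar>)"
  have K0: "0 \<le> K" unfolding K_def using q_nonneg by (auto intro!: sum_nonneg)
  have "\<forall>x\<in>S. \<bar>(L ^^ k) f x\<bar> \<le> K ^ k * M" for k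
  proof (induction k)
    case 0
    show ?case using finite_S by (auto simp: M_def intro!: member_le_sum[of _ S "\<lambda>x. \<bar>f x\<bar>"])
  next
    case (Suc k)
    let ?g = "(L ^^ k) f"
    show ?case
    proof
      fix x assume x: "x \<in> S"
      have "\<bar>L ?g x\<bar> \<le> (\<Sum>y\<in>S. \<bar>q x y * (?g y - ?g x)\<bar>)"
        unfolding L_eq[OF x] by (rule sum_abs)
      also have "\<dots> \<le> (\<Sum>y\<in>S. q x y * (2 * (K ^ k * M)))"
      proof (rule sum_mono)
        fix y assume y: "y \<in> S"
        have "\<bar>?g y - ?g x\<bar> \<le> 2 * (K ^ k * M)"
          using bspec[OF Suc x] bspec[OF Suc y] by linarith
        then show "\<bar>q x y * (?g y - ?g x)\<bar> \<le> q x y * (2 * (K ^ k * M))"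
          using q_nonneg[OF x y] by (simp add: abs_mult mult_left_mono)
      qed
      also have "\<dots> = 2 * (\<Sum>y\<in>S. q x y) * (K ^ k * M)"
        by (simp add: sum_distrib_right sum_distrib_left algebra_simps)
      also have "\<dots> \<le> K * (K ^ k * M)"
      proof (rule mult_right_mono)
        show "2 * (\<Sum>y\<in>S. q x y) \<le> K"
          unfolding K_def using finite_S x q_nonneg
          by (auto intro!: member_le_sum[of x S "\<lambda>x. \<Sum>y\<in>S. q x y"] sum_nonneg)
        show "0 \<le> K ^ k * M" using K0 by (auto simp: M_def intro!: sum_nonneg)
      qed
      finally show "\<bar>(L ^^ Suc k) f x\<bar> \<le> K ^ Suc k * M" by simp
    qed
  qed
  with K0 show ?thesis using that by blast
qed

lemma semigroup_summable:
  assumes x: "x \<in> S"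
  shows "summable (\<lambda>k. t ^ k / fact k * (L ^^ k) f x)"
proof -
  obtain K M where K: "0 \<le> K" "\<And>k x. x \<in> S \<Longrightarrow> \<bar>(L ^^ k) f x\<bar> \<le> K ^ k * M"
    using iterate_bound[of f] by blast
  show ?thesis
  proof (rule summable_comparison_test')
    show "summable (\<lambda>k. M * (inverse (fact k) * (\<bar>t\<bar> * K) ^ k))"
      by (intro summable_mult summable_exp)
    show "norm (t ^ k / fact k * (L ^^ k) f x) \<le> M * (inverse (fact k) * (\<bar>t\<bar> * K) ^ k)" for k
      using mult_left_mono[OF K(2)[OF x, of k], of "\<bar>t\<bar> ^ k / fact k"]
      by (simp add: abs_mult power_abs power_mult_distrib field_simps)
  qed
qed

lemma sum_semigroup_sums:
  "(\<lambda>k. (\<Sum>x\<in>S. v x * (L ^^ k) f x) / fact k * t ^ k) sums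
    (\<Sum>x\<in>S. v x * semigroup_of L t f x)"
proof -
  have "(\<lambda>k. \<Sum>x\<in>S. v x * (t ^ k / fact k * (L ^^ k) f x)) sums
      (\<Sum>x\<in>S. v x * semigroup_of L t f x)"
    unfolding semigroup_of_def
    by (intro sums_sum sums_mult summable_sums semigroup_summable)
  moreover have "(\<Sum>x\<in>S. v x * (t ^ k / fact k * (L ^^ k) f x))
      = (\<Sum>x\<in>S. v x * (L ^^ k) f x) / fact k * t ^ k" for k
    by (simp add: sum_divide_distrib sum_distrib_left mult_ac)
  ultimately show ?thesis by simp
qed

text \<open>The weighted semigroup is a power series in \<open>t\<close> whose linear coefficient is
  the weighted sum of \<open>L f\<close>. Invariance forces this coefficient to vanish; conversely,
  annihilation applied to the iterates of \<open>L\<close> on \<open>f\<close> kills every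
  coefficient except the constant one.\<close>

lemma semigroup_invariant_iff:
  "(\<forall>t\<ge>0. \<forall>f. (\<Sum>x\<in>S. v x * semigroup_of L t f x) = (\<Sum>x\<in>S. v x * f x)) \<longleftrightarrow> annihilates v"
proof
  assume inv: "\<forall>t\<ge>0. \<forall>f. (\<Sum>x\<in>S. v x * semigroup_of L t f x) = (\<Sum>x\<in>S. v x * f x)"
  show "annihilates v"
    unfolding annihilates_def
  proof
    fix f
    define a where "a k = (\<Sum>x\<in>S. v x * (L ^^ k) f x) / fact k" for k
    define g where "g t = (\<Sum>x\<in>S. v x * semigroup_of L t f x)" for t
    have "(\<lambda>k. a (Suc k) * t ^ k) sums ((g t - a 0) / t)" if "t \<noteq> 0" for t
    proof -
      have "(\<lambda>k. a k * t ^ k) sums g t" unfolding a_def g_def by (rule sum_semigroup_sums)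
      then have "(\<lambda>k. a (Suc k) * t ^ Suc k) sums (g t - a 0)"
        using sums_Suc_iff[of "\<lambda>k. a k * t ^ k" "g t - a 0"] by simp
      from sums_divide[OF this, of t] show ?thesis using that by simp
    qed
    then have "((\<lambda>t. (g t - a 0) / t) \<longlongrightarrow> a (Suc 0)) (at 0)"
      by (rule powser_limit_0_strong[of 1 "\<lambda>k. a (Suc k)", OF zero_less_one])
    \<comment> \<open>Invariance is given for \<open>t >= 0\<close> only, so the difference quotient
      is evaluated from the right.\<close>
    then have "((\<lambda>t. (g t - a 0) / t) \<longlongrightarrow> a (Suc 0)) (at_right 0)"
      by (rule filterlim_mono[OF _ order_refl at_le]) simp
    moreover have "\<forall>\<^sub>F t in at_right 0. (g t - a 0) / t = 0"
      using inv by (intro eventually_at_rightI[of 0 1]) (auto simp: g_def a_def)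
    ultimately have "((\<lambda>t. 0) \<longlongrightarrow> a (Suc 0)) (at_right (0::real))"
      by (rule Lim_transform_eventually)
    then have "a (Suc 0) = 0"
      by (rule tendsto_unique[OF trivial_limit_at_right_real _ tendsto_const])
    then show "(\<Sum>x\<in>S. v x * L f x) = 0" by (simp add: a_def)
  qed
next
  assume v: "annihilates v"
  show "\<forall>t\<ge>0. \<forall>f. (\<Sum>x\<in>S. v x * semigroup_of L t f x) = (\<Sum>x\<in>S. v x * f x)"
  proof (intro allI impI)
    fix t :: real and f
    define a where "a k = (\<Sum>x\<in>S. v x * (L ^^ k) f x) / fact k" for k
    have "a (Suc k) = 0" for k
      using v by (simp add: a_def annihilates_def)
    then have "a k * t ^ k = (if k = 0 then a 0 else 0)" for k by (cases k) auto
    then have "(\<lambda>k. a k * t ^ k) sums a 0" using sums_single[of 0 "\<lambda>_. a 0"] by simp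
    from sums_unique2[OF sum_semigroup_sums[of v f t, folded a_def] this]
    show "(\<Sum>x\<in>S. v x * semigroup_of L t f x) = (\<Sum>x\<in>S. v x * f x)"
      by (simp add: a_def)
  qed
qed

lemma annihilating_pmf_exists:
  assumes "S \<noteq> {}"
  shows "\<exists>p. set_pmf p \<subseteq> S \<and> annihilates (pmf p)"
proof -
  obtain v where v: "\<forall>x\<in>S. 0 \<le> v x" "0 < sum v S"
      "\<forall>y\<in>S. (\<Sum>x\<in>S. v x * q x y) = v y * (\<Sum>x\<in>S. q y x)"
    using balanced_weights_exist[of S q] finite_S assms q_nonneg by blast
  obtain p where p: "set_pmf p \<subseteq> S" "\<forall>x\<in>S. pmf p x = v x / sum v S"
    using pmf_of_weights_exists[of S "\<lambda>x. v x / sum v S"] finite_S v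
    by (auto simp: sum_divide_distrib[symmetric])
  have "(\<Sum>x\<in>S. pmf p x * q x y) = (\<Sum>x\<in>S. v x * q x y) / sum v S" for y
    using p(2) by (simp add: sum_divide_distrib cong: sum.cong)
  then have "annihilates (pmf p)"
    unfolding annihilates_iff_balance using p v by simp
  with p show ?thesis by blast
qed

end

subsection \<open>The stationary measure of the exclusion process\<close>

text \<open>Each move contributes its rate to the configuration it produces; exchanges of equal
  occupations contribute to the diagonal.\<close>

definition jump_rate :: "real \<Rightarrow> real \<Rightarrow> nat \<Rightarrow> (nat \<Rightarrow> nat) \<Rightarrow> (nat \<Rightarrow> nat) \<Rightarrow> real" where
  "jump_rate \<alpha> \<beta> N \<eta> \<zeta> =
    (real N)\<^sup>2 * (\<Sum>x = 1..N - 2. of_bool (exchange x (x + 1) \<eta> = \<zeta>)) +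
    (\<Sum>x\<in>{1, N - 1}.
      (reservoir \<alpha> \<beta> x * (1 - real (\<eta> x)) + (1 - reservoir \<alpha> \<beta> x) * real (\<eta> x))
        * of_bool (flip x \<eta> = \<zeta>))"

lemma finite_sites [simp]: "finite (sites N)"
  by (simp add: sites_def)

lemma finite_configs: "finite (configs N)"
  unfolding configs_def by (intro finite_PiE) auto

lemma configs_range: "\<eta> \<in> configs N \<Longrightarrow> x \<in> sites N \<Longrightarrow> \<eta> x = 0 \<or> \<eta> x = 1"
  unfolding configs_def by fastforce

text \<open>As a relabelling of sites, an exchange turns the occupation variable at \<open>x\<close>
  into the one at the transposed site. This makes the moment equations below close.\<close>

lemma exchange_eq_comp: "exchange x y \<eta> = \<eta> \<circ> Transposition.transpose x y"
  by (auto simp: exchange_def Transposition.transpose_def fun_eq_iff)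

lemma exchange_in_configs:
  "\<eta> \<in> configs N \<Longrightarrow> x \<in> sites N \<Longrightarrow> y \<in> sites N \<Longrightarrow> exchange x y \<eta> \<in> configs N"
  by (auto simp: exchange_def configs_def PiE_iff extensional_def)

lemma flip_in_configs: "\<eta> \<in> configs N \<Longrightarrow> x \<in> sites N \<Longrightarrow> flip x \<eta> \<in> configs N"
  by (auto simp: flip_def configs_def PiE_iff extensional_def)

locale exclusion =
  fixes \<alpha> \<beta> :: real and N :: nat
  assumes \<alpha>: "0 < \<alpha>" "\<alpha> < 1" and \<beta>: "0 < \<beta>" "\<beta> < 1" and N: "3 \<le> N"
begin

abbreviation "r \<equiv> reservoir \<alpha> \<beta>"
abbreviation "flip_rate x \<eta> \<equiv> r x * (1 - real (\<eta> x)) + (1 - r x) * real (\<eta> x)"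

lemma reservoir_bounds: "0 < r x" "r x < 1"
  using \<alpha> \<beta> by (auto simp: reservoir_def)

lemma boundary_in_sites: "x \<in> {1, N - 1} \<Longrightarrow> x \<in> sites N"
  using N by (auto simp: sites_def)

lemma bulk_in_sites: "x \<in> {1..N - 2} \<Longrightarrow> x \<in> sites N" "x \<in> {1..N - 2} \<Longrightarrow> x + 1 \<in> sites N"
  using N by (auto simp: sites_def)

lemma flip_rate_pos: "\<eta> \<in> configs N \<Longrightarrow> x \<in> sites N \<Longrightarrow> 0 < flip_rate x \<eta>"
  using configs_range[of \<eta> N x] reservoir_bounds[of x] by auto

lemma flip_rates_nonneg:
  assumes "\<eta> \<in> configs N"
  shows "0 \<le> (\<Sum>x\<in>{1, N - 1}. flip_rate x \<eta> * of_bool (P x))"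
proof (rule sum_nonneg)
  fix x assume "x \<in> {1, N - 1}"
  from flip_rate_pos[OF assms boundary_in_sites[OF this]]
  show "0 \<le> flip_rate x \<eta> * of_bool (P x)" by simp
qed

sublocale jump_process "configs N" "jump_rate \<alpha> \<beta> N" "gen \<alpha> \<beta> N"
proof
  show "finite (configs N)" by (rule finite_configs)
  show "0 \<le> jump_rate \<alpha> \<beta> N \<eta> \<zeta>" if "\<eta> \<in> configs N" for \<eta> \<zeta>
    unfolding jump_rate_def
    by (intro add_nonneg_nonneg flip_rates_nonneg that mult_nonneg_nonneg sum_nonneg) auto
  show "gen \<alpha> \<beta> N f \<eta> = (\<Sum>\<zeta>\<in>configs N. jump_rate \<alpha> \<beta> N \<eta> \<zeta> * (f \<zeta> - f \<eta>))"
    if \<eta>: "\<eta> \<in> configs N" for f \<eta>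
  proof -
    have single: "(\<Sum>\<zeta>\<in>configs N. of_bool (\<xi> = \<zeta>) * (f \<zeta> - f \<eta>)) = f \<xi> - f \<eta>"
      if "\<xi> \<in> configs N" for \<xi>
    proof -
      have "(\<Sum>\<zeta>\<in>configs N. of_bool (\<xi> = \<zeta>) * (f \<zeta> - f \<eta>))
          = (\<Sum>\<zeta>\<in>configs N. if \<xi> = \<zeta> then f \<zeta> - f \<eta> else 0)"
        by (intro sum.cong) auto
      then show ?thesis using that finite_configs by simp
    qed
    have "(\<Sum>\<zeta>\<in>configs N. jump_rate \<alpha> \<beta> N \<eta> \<zeta> * (f \<zeta> - f \<eta>))
        = (real N)\<^sup>2 * (\<Sum>\<zeta>\<in>configs N. \<Sum>x = 1..N - 2.
              of_bool (exchange x (x + 1) \<eta> = \<zeta>) * (f \<zeta> - f \<eta>))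
          + (\<Sum>\<zeta>\<in>configs N. \<Sum>x\<in>{1, N - 1}.
              flip_rate x \<eta> * (of_bool (flip x \<eta> = \<zeta>) * (f \<zeta> - f \<eta>)))"
      unfolding jump_rate_def distrib_right sum.distrib
      by (simp only: sum_distrib_left sum_distrib_right mult.assoc)
    also have "(\<Sum>\<zeta>\<in>configs N. \<Sum>x = 1..N - 2.
        of_bool (exchange x (x + 1) \<eta> = \<zeta>) * (f \<zeta> - f \<eta>)) = bulk_gen N f \<eta>"
      unfolding bulk_gen_def
      by (subst sum.swap)
        (intro sum.cong refl single exchange_in_configs \<eta> bulk_in_sites)
    also have "(\<Sum>\<zeta>\<in>configs N. \<Sum>x\<in>{1, N - 1}.
        flip_rate x \<eta> * (of_bool (flip x \<eta> = \<zeta>) * (f \<zeta> - f \<eta>))) = boundary_gen \<alpha> \<beta> N f \<eta>"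
      unfolding boundary_gen_def
      by (subst sum.swap, unfold sum_distrib_left[symmetric],
          intro sum.cong refl arg_cong2[where f = "(*)"] single flip_in_configs \<eta> boundary_in_sites)
    finally show ?thesis by (simp add: gen_def)
  qed
qed

lemma jump_rate_exchange_pos:
  assumes "\<eta> \<in> configs N" "x \<in> {1..N - 2}"
  shows "0 < jump_rate \<alpha> \<beta> N \<eta> (exchange x (x + 1) \<eta>)"
proof -
  have "0 < (\<Sum>z = 1..N - 2. of_bool (exchange z (z + 1) \<eta> = exchange x (x + 1) \<eta>) :: real)"
    using assms(2) by (intro sum_pos2[of _ x]) auto
  then show ?thesis
    unfolding jump_rate_def using N
    by (intro add_pos_nonneg mult_pos_pos flip_rates_nonneg assms) auto
qed

lemma jump_rate_flip_pos:
  assumes "\<eta> \<in> configs N" "x \<in> {1, N - 1}"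
  shows "0 < jump_rate \<alpha> \<beta> N \<eta> (flip x \<eta>)"
proof -
  have "0 < (\<Sum>z\<in>{1, N - 1}. flip_rate z \<eta> * of_bool (flip z \<eta> = flip x \<eta>))"
  proof (rule sum_pos2)
    show "0 < flip_rate x \<eta> * of_bool (flip x \<eta> = flip x \<eta>)"
      using flip_rate_pos[OF assms(1) boundary_in_sites[OF assms(2)]] by simp
    show "0 \<le> flip_rate z \<eta> * of_bool (flip z \<eta> = flip x \<eta>)" if "z \<in> {1, N - 1}" for z
      using flip_rate_pos[OF assms(1) boundary_in_sites[OF that]] by simp
  qed (use assms in auto)
  then show ?thesis
    unfolding jump_rate_def by (intro add_nonneg_pos mult_nonneg_nonneg sum_nonneg) auto
qed

text \<open>Moving the leftmost particle to the left, or removing it at site \<open>1\<close>, lowers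
  \<open>\<Sum>x. x * \<eta> x\<close>, so the minimizer of this sum in a closed set has no particle.\<close>

lemma empty_config_reachable:
  assumes Z: "Z \<subseteq> configs N" "Z \<noteq> {}"
    and closed: "\<And>\<eta> \<zeta>. \<eta> \<in> Z \<Longrightarrow> \<zeta> \<in> configs N \<Longrightarrow> 0 < jump_rate \<alpha> \<beta> N \<eta> \<zeta> \<Longrightarrow> \<zeta> \<in> Z"
  shows "(\<lambda>x\<in>sites N. 0) \<in> Z"
proof -
  define m where "m \<eta> = (\<Sum>x\<in>sites N. x * \<eta> x)" for \<eta> :: "nat \<Rightarrow> nat"
  obtain \<eta> where \<eta>: "\<eta> \<in> Z" and least: "\<And>\<zeta>. \<zeta> \<in> Z \<Longrightarrow> m \<eta> \<le> m \<zeta>"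
    using ex_has_least_nat[of "\<lambda>\<eta>. \<eta> \<in> Z" _ m] Z(2) by blast
  have conf: "\<eta> \<in> configs N" using \<eta> Z by blast
  have "\<eta> x = 0" if "x \<in> sites N" for x
    using that
  proof (induction x rule: less_induct)
    case (less x)
    show ?case
    proof (rule ccontr)
      assume "\<eta> x \<noteq> 0"
      then have x1: "\<eta> x = 1" using configs_range[OF conf less.prems] by simp
      show False
      proof (cases "x = 1")
        case True
        have "flip 1 \<eta> \<in> Z"
          by (rule closed[OF \<eta> flip_in_configs[OF conf boundary_in_sites] jump_rate_flip_pos[OF conf]])
            auto
        moreover have "m (flip 1 \<eta>) < m \<eta>"
          unfolding m_def flip_def using True x1 less.prems by (intro sum_strict_mono_ex1) auto
        ultimately show False using least by fastforce
      next
        case False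
        with less.prems N have x: "x - 1 \<in> {1..N - 2}" "x - 1 + 1 = x" "x - 1 < x" "x - 1 \<in> sites N"
          by (auto simp: sites_def)
        let ?\<zeta> = "exchange (x - 1) (x - 1 + 1) \<eta>"
        have x0: "\<eta> (x - 1) = 0" using less.IH x by blast
        have "?\<zeta> \<in> Z"
          by (rule closed[OF \<eta> exchange_in_configs[OF conf bulk_in_sites]
                jump_rate_exchange_pos[OF conf]]) (rule x)+
        moreover have "m ?\<zeta> < m \<eta>"
        proof -
          have \<zeta>: "?\<zeta> = \<eta>(x - 1 := 1, x := 0)" using x x0 x1 by (simp add: exchange_def)
          have split: "m \<xi> = x * \<xi> x + ((x - 1) * \<xi> (x - 1) + (\<Sum>z\<in>sites N - {x} - {x - 1}. z * \<xi> z))"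
            for \<xi>
            unfolding m_def using x less.prems
            by (subst sum.remove[of _ x], simp, simp, subst sum.remove[of _ "x - 1"]) auto
          have "(\<Sum>z\<in>sites N - {x} - {x - 1}. z * ?\<zeta> z) = (\<Sum>z\<in>sites N - {x} - {x - 1}. z * \<eta> z)"
            unfolding \<zeta> by (intro sum.cong) auto
          moreover have "?\<zeta> x = 0" "?\<zeta> (x - 1) = 1" unfolding \<zeta> using x(3) by simp_all
          ultimately show ?thesis unfolding split using x(3) x0 x1 by simp
        qed
        ultimately show False using least by fastforce
      qed
    qed
  qed
  then have "\<eta> = (\<lambda>x\<in>sites N. 0)"
    using conf by (auto simp: configs_def PiE_iff extensional_def fun_eq_iff)
  with \<eta> show ?thesis by simp
qed

lemma expectation_eq_sum:
  assumes "set_pmf p \<subseteq> configs N"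
  shows "measure_pmf.expectation p f = (\<Sum>\<eta>\<in>configs N. pmf p \<eta> * f \<eta>)"
  using assms finite_configs by (subst integral_measure_pmf_real) (auto simp: mult.commute)

lemma stationary_iff:
  "stationary \<alpha> \<beta> N p \<longleftrightarrow> set_pmf p \<subseteq> configs N \<and> annihilates (pmf p)"
  unfolding stationary_def semigroup_invariant_iff[symmetric]
  by (auto simp: expectation_eq_sum)

text \<open>Justifies the definite description: balanced weights give existence, and the empty
  configuration, contained in every nonempty closed set, gives uniqueness among weights of total
  mass 1.\<close>

lemma stationary_mu_ss: "stationary \<alpha> \<beta> N (mu_ss \<alpha> \<beta> N)"
  unfolding mu_ss_def
proof (rule theI')
  have "(\<lambda>x\<in>sites N. 0) \<in> configs N" by (simp add: configs_def)
  then obtain p where p: "set_pmf p \<subseteq> configs N" "annihilates (pmf p)"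
    using annihilating_pmf_exists by blast
  show "\<exists>!p. stationary \<alpha> \<beta> N p"
  proof (rule ex1I[of _ p])
    show "stationary \<alpha> \<beta> N p" using p by (simp add: stationary_iff)
    fix p' assume p': "stationary \<alpha> \<beta> N p'"
    show "p' = p"
    proof (rule pmf_eqI)
      fix \<eta>
      show "pmf p' \<eta> = pmf p \<eta>"
      proof (cases "\<eta> \<in> configs N")
        case True
        have "sum (pmf p') (configs N) = sum (pmf p) (configs N)"
          using p p' finite_configs by (simp add: sum_pmf_eq_1 stationary_iff)
        moreover have "annihilates (pmf p')" using p' by (simp add: stationary_iff)
        ultimately show ?thesis
          by (intro annihilates_unique[OF _ p(2) _ empty_config_reachable True])
      next
        case False
        then show ?thesis using p p' by (metis pmf_eq_0_set_pmf stationary_iff subsetD)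
      qed
    qed
  qed
qed

end

subsection \<open>Stationary means and covariances\<close>

context exclusion
begin

abbreviation "\<mu> \<equiv> measure_pmf (mu_ss \<alpha> \<beta> N)"
abbreviation "\<gamma> \<equiv> (\<alpha> + \<beta>) / 2"
abbreviation "\<tau> z \<equiv> Transposition.transpose z (z + 1)"

definition h :: "nat \<Rightarrow> (nat \<Rightarrow> nat) \<Rightarrow> real" where
  "h x \<eta> = real (\<eta> x) - \<gamma>"

definition \<phi> :: "nat \<Rightarrow> real" where
  "\<phi> x = integral\<^sup>L \<mu> (h x)"

text \<open>Centred at \<gamma> rather than at the stationary means, so it exceeds the true
  covariance by \<open>\<phi> x * \<phi> y\<close>.\<close>

definition cov :: "nat \<Rightarrow> nat \<Rightarrow> real" where
  "cov x y = integral\<^sup>L \<mu> (\<lambda>\<eta>. h x \<eta> * h y \<eta>)"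

lemma set_pmf_mu_ss: "set_pmf (mu_ss \<alpha> \<beta> N) \<subseteq> configs N"
  using stationary_mu_ss by (simp add: stationary_iff)

lemma integrable_mu_ss [simp]: "integrable \<mu> (f :: _ \<Rightarrow> real)"
  using set_pmf_mu_ss finite_configs by (intro integrable_measure_pmf_finite) (rule finite_subset)

lemma expectation_cong:
  "(\<And>\<eta>. \<eta> \<in> configs N \<Longrightarrow> f \<eta> = g \<eta>) \<Longrightarrow> integral\<^sup>L \<mu> f = (integral\<^sup>L \<mu> g :: real)"
  using set_pmf_mu_ss by (intro integral_cong_AE) (auto simp: AE_measure_pmf_iff)

lemma expectation_mono:
  "(\<And>\<eta>. \<eta> \<in> configs N \<Longrightarrow> f \<eta> \<le> g \<eta>) \<Longrightarrow> integral\<^sup>L \<mu> f \<le> (integral\<^sup>L \<mu> g :: real)"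
  using set_pmf_mu_ss by (intro integral_mono_AE) (auto simp: AE_measure_pmf_iff)

lemma expectation_gen: "integral\<^sup>L \<mu> (gen \<alpha> \<beta> N f) = 0"
  using stationary_mu_ss by (simp add: stationary_iff expectation_eq_sum annihilates_def)

lemma \<tau>_in_sites: "z \<in> {1..N - 2} \<Longrightarrow> x \<in> sites N \<Longrightarrow> \<tau> z x \<in> sites N"
  using bulk_in_sites[of z] by (auto simp: Transposition.transpose_def)

lemma h_exchange: "h x (exchange z (z + 1) \<eta>) = h (\<tau> z x) \<eta>"
  by (simp add: h_def exchange_eq_comp)

text \<open>For an occupation \<open>e\<close> in \<open>{0, 1}\<close>, the flip rate times the
  increment \<open>1 - 2 * e\<close> equals \<open>r z - e\<close>.\<close>

lemma h_flip_diff: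
  assumes "\<eta> \<in> configs N" "z \<in> {1, N - 1}"
  shows "flip_rate z \<eta> * (h x (flip z \<eta>) - h x \<eta>) = of_bool (z = x) * (r z - \<gamma> - h x \<eta>)"
  using configs_range[OF assms(1) boundary_in_sites[OF assms(2)]]
  by (auto simp: h_def flip_def)

text \<open>As \<open>x\<close> and \<open>y\<close> differ, a flip changes at most one factor, and
  \<open>h_flip_diff\<close> applies to that one.\<close>

lemma hh_flip_diff:
  assumes "\<eta> \<in> configs N" "z \<in> {1, N - 1}" "x \<noteq> y"
  shows "flip_rate z \<eta> * (h x (flip z \<eta>) * h y (flip z \<eta>) - h x \<eta> * h y \<eta>) =
    of_bool (z = x) * ((r z - \<gamma>) * h y \<eta> - h x \<eta> * h y \<eta>) +
    of_bool (z = y) * ((r z - \<gamma>) * h x \<eta> - h x \<eta> * h y \<eta>)"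
proof -
  have *: "h w (flip z \<eta>) = h w \<eta>" if "z \<noteq> w" for w
    using that by (simp add: h_def flip_def)
  have **: "flip_rate z \<eta> * (h z (flip z \<eta>) - h z \<eta>) = r z - \<gamma> - h z \<eta>"
    using h_flip_diff[OF assms(1,2), of z] by simp
  consider "z = x" "z \<noteq> y" | "z = y" "z \<noteq> x" | "z \<noteq> x" "z \<noteq> y" using assms(3) by blast
  then show ?thesis
  proof cases
    case 1
    have "flip_rate z \<eta> * (h x (flip z \<eta>) * h y (flip z \<eta>) - h x \<eta> * h y \<eta>)
        = flip_rate z \<eta> * (h z (flip z \<eta>) - h z \<eta>) * h y \<eta>"
      unfolding *[OF 1(2)] unfolding 1(1) by (simp add: algebra_simps)
    then show ?thesis using 1 unfolding ** by (simp add: algebra_simps)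
  next
    case 2
    have "flip_rate z \<eta> * (h x (flip z \<eta>) * h y (flip z \<eta>) - h x \<eta> * h y \<eta>)
        = flip_rate z \<eta> * (h z (flip z \<eta>) - h z \<eta>) * h x \<eta>"
      unfolding *[OF 2(2)] unfolding 2(1) by (simp add: algebra_simps)
    then show ?thesis using 2 unfolding ** by (simp add: algebra_simps)
  qed (simp add: *)
qed

lemma \<phi>_equation:
  "(real N)\<^sup>2 * (\<Sum>z = 1..N - 2. \<phi> (\<tau> z x) - \<phi> x) +
    (\<Sum>z\<in>{1, N - 1}. of_bool (z = x) * (r z - \<gamma> - \<phi> x)) = 0"
proof -
  have "0 = integral\<^sup>L \<mu> (gen \<alpha> \<beta> N (h x))" by (simp only: expectation_gen)
  also have "\<dots> = integral\<^sup>L \<mu> (\<lambda>\<eta>. (real N)\<^sup>2 * (\<Sum>z = 1..N - 2. h (\<tau> z x) \<eta> - h x \<eta>) +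
      (\<Sum>z\<in>{1, N - 1}. of_bool (z = x) * (r z - \<gamma> - h x \<eta>)))"
    unfolding gen_def bulk_gen_def boundary_gen_def h_exchange
    by (intro expectation_cong arg_cong2[where f = "(+)"] refl sum.cong h_flip_diff)
  also have "\<dots> = (real N)\<^sup>2 * (\<Sum>z = 1..N - 2. \<phi> (\<tau> z x) - \<phi> x) +
      (\<Sum>z\<in>{1, N - 1}. of_bool (z = x) * (r z - \<gamma> - \<phi> x))"
    by (simp add: \<phi>_def Bochner_Integration.integral_sum del: sum.insert)
  finally show ?thesis by simp
qed

text \<open>The generator maps products over two distinct sites to such products plus boundary terms
  of degree one, so no higher moments enter.\<close>

lemma cov_equation:
  assumes "x \<noteq> y"
  shows "(real N)\<^sup>2 * (\<Sum>z = 1..N - 2. cov (\<tau> z x) (\<tau> z y) - cov x y) +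
    (\<Sum>z\<in>{1, N - 1}. of_bool (z = x) * ((r z - \<gamma>) * \<phi> y - cov x y) +
      of_bool (z = y) * ((r z - \<gamma>) * \<phi> x - cov x y)) = 0"
proof -
  have "0 = integral\<^sup>L \<mu> (gen \<alpha> \<beta> N (\<lambda>\<eta>. h x \<eta> * h y \<eta>))" by (simp only: expectation_gen)
  also have "\<dots> = integral\<^sup>L \<mu> (\<lambda>\<eta>.
      (real N)\<^sup>2 * (\<Sum>z = 1..N - 2. h (\<tau> z x) \<eta> * h (\<tau> z y) \<eta> - h x \<eta> * h y \<eta>) +
      (\<Sum>z\<in>{1, N - 1}. of_bool (z = x) * ((r z - \<gamma>) * h y \<eta> - h x \<eta> * h y \<eta>) +
        of_bool (z = y) * ((r z - \<gamma>) * h x \<eta> - h x \<eta> * h y \<eta>)))"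
    unfolding gen_def bulk_gen_def boundary_gen_def h_exchange
    by (intro expectation_cong arg_cong2[where f = "(+)"] refl sum.cong hh_flip_diff assms)
  also have "\<dots> = (real N)\<^sup>2 * (\<Sum>z = 1..N - 2. cov (\<tau> z x) (\<tau> z y) - cov x y) +
    (\<Sum>z\<in>{1, N - 1}. of_bool (z = x) * ((r z - \<gamma>) * \<phi> y - cov x y) +
      of_bool (z = y) * ((r z - \<gamma>) * \<phi> x - cov x y))"
    by (simp add: \<phi>_def cov_def Bochner_Integration.integral_sum del: sum.insert)
  finally show ?thesis by simp
qed

text \<open>Only the bonds to the right and left of \<open>x\<close> move it, and the conditions say
  when these exist: this is the discrete Laplacian with reflecting ends.\<close>

lemma sum_\<tau>_diff:
  fixes f :: "nat \<Rightarrow> real"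
  assumes "x \<in> sites N"
  shows "(\<Sum>z = 1..N - 2. f (\<tau> z x) - f x) =
    (if x \<le> N - 2 then f (x + 1) - f x else 0) - (if 2 \<le> x then f x - f (x - 1) else 0)"
proof -
  have "f (\<tau> z x) - f x = (if z = x then f (x + 1) - f x else 0) - (if z = x - 1 then f x - f (x - 1) else 0)"
    if "z \<in> {1..N - 2}" for z
    using that assms by (auto simp: Transposition.transpose_def sites_def)
  then have "(\<Sum>z = 1..N - 2. f (\<tau> z x) - f x) = (\<Sum>z = 1..N - 2. if z = x then f (x + 1) - f x else 0)
      - (\<Sum>z = 1..N - 2. if z = x - 1 then f x - f (x - 1) else 0)"
    unfolding sum_subtractf[symmetric] by (intro sum.cong) auto
  then show ?thesis using assms N by (auto simp: sites_def)
qed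

lemma \<phi>_bound:
  assumes x: "x \<in> sites N"
  shows "\<bar>\<phi> x\<bar> \<le> 1 / real N"
proof -
  define j where "j = \<phi> (1 + 1) - \<phi> 1"
  have N0: "0 < real N" and Nr: "real (N - 2) = real N - 2" using N by (auto simp: of_nat_diff)
  have left: "(real N)\<^sup>2 * j + (\<alpha> - \<gamma> - \<phi> 1) = 0"
  proof -
    have "1 \<in> sites N" "1 \<le> N - 2" "1 \<noteq> N - 1" using N by (auto simp: sites_def)
    then show ?thesis
      using \<phi>_equation[of 1] sum_\<tau>_diff[of 1 \<phi>] by (simp add: j_def reservoir_def)
  qed
  have bulk: "\<phi> (x + 1) - \<phi> x = \<phi> x - \<phi> (x - 1)" if "2 \<le> x" "x \<le> N - 2" for x
  proof -
    have "x \<in> sites N" "x \<noteq> 1" "x \<noteq> N - 1" using that by (auto simp: sites_def)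
    then show ?thesis using \<phi>_equation[of x] sum_\<tau>_diff[of x \<phi>] N0 that by auto
  qed
  have right: "- (real N)\<^sup>2 * (\<phi> (N - 1) - \<phi> (N - 2)) + (\<beta> - \<gamma> - \<phi> (N - 1)) = 0"
  proof -
    have "N - 1 - 1 = N - 2" "\<not> N - 1 \<le> N - 2" "2 \<le> N - 1" "N - 1 \<noteq> 1" "N - 1 \<in> sites N"
      using N by (auto simp: sites_def)
    then show ?thesis
      using \<phi>_equation[of "N - 1"] sum_\<tau>_diff[of "N - 1" \<phi>]
      by (simp add: reservoir_def right_diff_distrib del: One_nat_def)
  qed
  have slope: "\<phi> (x + 1) - \<phi> x = j" if "1 \<le> x" "x \<le> N - 2" for x
    using that
  proof (induction x rule: dec_induct)
    case base
    show ?case by (simp add: j_def)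
  next
    case (step n)
    then show ?case using bulk[of "Suc n"] by simp
  qed
  have lin: "\<phi> x = \<phi> 1 + (real x - 1) * j" if "1 \<le> x" "x \<le> N - 1" for x
    using that
  proof (induction x rule: dec_induct)
    case (step n)
    then show ?case using slope[of n] by (simp add: algebra_simps)
  qed simp
  have "\<phi> (N - 1) - \<phi> (N - 2) = j"
    using slope[of "N - 2"] N by (simp add: Suc_diff_Suc numeral_2_eq_2)
  with right have "- (real N)\<^sup>2 * j + (\<beta> - \<gamma> - \<phi> (N - 1)) = 0" by simp
  moreover have "\<phi> (N - 1) = \<phi> 1 + (real N - 2) * j"
    using lin[of "N - 1"] N by (simp add: of_nat_diff)
  \<comment> \<open>Adding the two boundary equations gives
    \<open>\<phi> 1 + \<phi> (N - 1) = 0\<close>, because \<gamma> is the mean of \<alpha> and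
    \<beta>: the affine profile is odd about the midpoint.\<close>
  ultimately have \<phi>1: "\<phi> 1 = - ((real N - 2) / 2 * j)" using left by (simp add: field_simps)
  have "((real N)\<^sup>2 + (real N - 2) / 2) * j = \<gamma> - \<alpha>"
    using left unfolding \<phi>1 by (simp add: algebra_simps)
  then have "((real N)\<^sup>2 + (real N - 2) / 2) * \<bar>j\<bar> = \<bar>\<gamma> - \<alpha>\<bar>"
    using N by (metis abs_mult abs_of_nonneg add_nonneg_nonneg divide_nonneg_pos Nr
        of_nat_0_le_iff zero_le_power2 zero_less_numeral)
  moreover have "0 \<le> (real N - 2) / 2 * \<bar>j\<bar>" using N by simp
  moreover have "\<bar>\<gamma> - \<alpha>\<bar> \<le> 1" using \<alpha> \<beta> by (simp add: abs_le_iff field_simps)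
  ultimately have j: "(real N)\<^sup>2 * \<bar>j\<bar> \<le> 1" unfolding distrib_right by linarith
  have x': "1 \<le> x" "x \<le> N - 1" using x by (auto simp: sites_def)
  then have "\<phi> x = (real x - 1 - (real N - 2) / 2) * j"
    using lin[of x] \<phi>1 by (simp add: algebra_simps)
  then have "\<bar>\<phi> x\<bar> = \<bar>real x - 1 - (real N - 2) / 2\<bar> * \<bar>j\<bar>" by (simp add: abs_mult)
  also have "\<dots> \<le> real N * \<bar>j\<bar>"
  proof (rule mult_right_mono)
    have "1 \<le> real x" "real x \<le> real N" "3 \<le> real N" using x' N by auto
    then show "\<bar>real x - 1 - (real N - 2) / 2\<bar> \<le> real N" by (simp add: abs_le_iff field_simps)
  qed simp
  also have "\<dots> \<le> 1 / real N" using j N0 by (simp add: field_simps power2_eq_square)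
  finally show ?thesis .
qed

text \<open>Maximum principle: a bulk jump sends a pair of distinct sites to another one, so at a
  maximizer \<open>(x, y)\<close> without a boundary site all its neighbours are maximizers too. One of them has
  first component \<open>x - 1\<close>, so a maximizer with least \<open>x\<close> meets the boundary, where the reservoirs
  pull the covariance to a value of order \<open>1 / N\<close>.\<close>

lemma signed_cov_bound:
  assumes s: "s = 1 \<or> s = - 1" and xy: "x \<in> sites N" "y \<in> sites N" "x \<noteq> y"
  shows "s * cov x y \<le> 1 / real N"
proof (rule ccontr)
  \<comment> \<open>The sign \<open>s\<close> lets a single maximum principle yield both the upper
    and the lower bound.\<close>
  define D where "D = (\<lambda>(x, y). s * cov x y)"
  define P where "P = {(x, y). x \<in> sites N \<and> y \<in> sites N \<and> x \<noteq> y}"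
  assume "\<not> s * cov x y \<le> 1 / real N"
  have finP: "finite P"
    by (rule finite_subset[of _ "sites N \<times> sites N"]) (auto simp: P_def)
  define m where "m = Max (D ` P)"
  have "(x, y) \<in> P" using xy by (simp add: P_def)
  then have "D (x, y) \<le> m" using finP by (simp add: m_def)
  with \<open>\<not> s * cov x y \<le> 1 / real N\<close> have m: "1 / real N < m" by (simp add: D_def)
  have le_m: "D p \<le> m" if "p \<in> P" for p using that finP by (simp add: m_def)
  have "\<exists>p. p \<in> P \<and> D p = m"
    using Max_in[of "D ` P"] finP \<open>(x, y) \<in> P\<close> unfolding m_def by (metis empty_iff finite_imageI image_iff)
  then obtain p where p: "p \<in> P" "D p = m" and least: "\<And>p'. p' \<in> P \<Longrightarrow> D p' = m \<Longrightarrow> fst p \<le> fst p'"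
    using ex_has_least_nat[of "\<lambda>p. p \<in> P \<and> D p = m" _ fst] by blast
  obtain a b where ab: "p = (a, b)" by (cases p)
  have sites: "a \<in> sites N" "b \<in> sites N" "a \<noteq> b" and Dab: "s * cov a b = m"
    using p by (auto simp: ab P_def D_def)
  have \<tau>_mem: "(\<tau> z a, \<tau> z b) \<in> P" if "z \<in> {1..N - 2}" for z
  proof -
    have "\<tau> z a \<noteq> \<tau> z b" using sites(3) by (metis transpose_involutory)
    then show ?thesis using \<tau>_in_sites[OF that] sites by (simp add: P_def)
  qed
  let ?B = "\<lambda>z. of_bool (z = a) * (s * (r z - \<gamma>) * \<phi> b - m) + of_bool (z = b) * (s * (r z - \<gamma>) * \<phi> a - m)"
  \<comment> \<open>The source is at most \<open>1 / N\<close> in absolute value, since the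
    reservoir factor is at most 1 and the mean at most \<open>1 / N\<close>; the assumed maximum
    \<open>m\<close> is strictly larger.\<close>
  have source: "s * (r z - \<gamma>) * \<phi> w - m < 0" if "w \<in> sites N" for z w
  proof -
    have "r z = \<alpha> \<or> r z = \<beta>" by (simp add: reservoir_def)
    then have "\<bar>r z - \<gamma>\<bar> \<le> 1" using \<alpha> \<beta>
      by (auto simp: abs_le_iff field_simps)
    then have "\<bar>s * (r z - \<gamma>) * \<phi> w\<bar> \<le> 1 * (1 / real N)"
      using s \<phi>_bound[OF that] unfolding abs_mult by (intro mult_mono) auto
    then show ?thesis using m by linarith
  qed
  have B_le: "?B z \<le> 0" for z using source[OF sites(1)] source[OF sites(2)]
    by (intro add_nonpos_nonpos) (auto simp: less_imp_le)
  have A_le: "D (\<tau> z a, \<tau> z b) - m \<le> 0" if "z \<in> {1..N - 2}" for z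
    using le_m[OF \<tau>_mem[OF that]] by simp
  \<comment> \<open>The pair equation at the maximizer, times \<open>s\<close>. Its bulk and
    boundary parts are both nonpositive and add up to zero, so each vanishes.\<close>
  have "(real N)\<^sup>2 * (\<Sum>z = 1..N - 2. D (\<tau> z a, \<tau> z b) - m) + (\<Sum>z\<in>{1, N - 1}. ?B z)
      = s * ((real N)\<^sup>2 * (\<Sum>z = 1..N - 2. cov (\<tau> z a) (\<tau> z b) - cov a b) +
        (\<Sum>z\<in>{1, N - 1}. of_bool (z = a) * ((r z - \<gamma>) * \<phi> b - cov a b) +
          of_bool (z = b) * ((r z - \<gamma>) * \<phi> a - cov a b)))"
    unfolding distrib_left sum_distrib_left D_def Dab[symmetric]
    by (intro arg_cong2[where f = "(+)"] sum.cong) (auto simp: algebra_simps)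
  also have "\<dots> = 0" using cov_equation[OF sites(3)] by simp
  finally have eq: "(real N)\<^sup>2 * (\<Sum>z = 1..N - 2. D (\<tau> z a, \<tau> z b) - m) + (\<Sum>z\<in>{1, N - 1}. ?B z) = 0" .
  have "(real N)\<^sup>2 * (\<Sum>z = 1..N - 2. D (\<tau> z a, \<tau> z b) - m) \<le> 0"
    by (intro mult_nonneg_nonpos sum_nonpos A_le) auto
  moreover have "(\<Sum>z\<in>{1, N - 1}. ?B z) \<le> 0" by (intro sum_nonpos B_le)
  ultimately have A0: "(real N)\<^sup>2 * (\<Sum>z = 1..N - 2. D (\<tau> z a, \<tau> z b) - m) = 0"
    and B0: "(\<Sum>z\<in>{1, N - 1}. ?B z) = 0" using eq by linarith+
  show False
  proof (cases "a = 1")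
    case True
    have "?B 1 < 0" using source[OF sites(2), of 1] True sites(3) by simp
    moreover have "(\<Sum>z\<in>{1, N - 1}. ?B z) = ?B 1 + ?B (N - 1)" using N by simp
    ultimately show False using B0 B_le[of "N - 1"] by linarith
  next
    case False
    with sites have z: "a - 1 \<in> {1..N - 2}" "a - 1 + 1 = a" by (auto simp: sites_def)
    have "(\<Sum>z = 1..N - 2. m - D (\<tau> z a, \<tau> z b)) = 0"
      using A0 N by (simp add: sum_subtractf)
    \<comment> \<open>The bond \<open>a - 1\<close> lowers the first component to
      \<open>a - 1\<close> even if \<open>b = a - 1\<close>, when the two components are swapped.
      The new pair is again a maximizer, against the minimality of \<open>a\<close>.\<close>
    then have "m - D (\<tau> (a - 1) a, \<tau> (a - 1) b) = 0"
      using sum_nonneg_eq_0_iff[of "{1..N - 2}" "\<lambda>z. m - D (\<tau> z a, \<tau> z b)"] A_le z(1) by fastforce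
    then have "fst p \<le> fst (\<tau> (a - 1) a, \<tau> (a - 1) b)"
      using least[OF \<tau>_mem[OF z(1)]] by simp
    then show False using z by (simp add: ab Transposition.transpose_def split: if_splits)
  qed
qed

lemma cov_bound:
  assumes "x \<in> sites N" "y \<in> sites N" "x \<noteq> y"
  shows "\<bar>cov x y\<bar> \<le> 1 / real N"
  using signed_cov_bound[of 1, OF _ assms] signed_cov_bound[of "- 1", OF _ assms] by simp

lemma cov_diagonal_bound:
  assumes x: "x \<in> sites N"
  shows "\<bar>cov x x\<bar> \<le> 1"
proof -
  have "h x \<eta> * h x \<eta> \<le> 1" if "\<eta> \<in> configs N" for \<eta>
  proof -
    have "\<bar>h x \<eta>\<bar> \<le> 1"
      using configs_range[OF that x] \<alpha> \<beta> unfolding h_def by fastforce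
    then show ?thesis using mult_le_one[of "\<bar>h x \<eta>\<bar>" "\<bar>h x \<eta>\<bar>"] by (simp add: abs_mult_self_eq)
  qed
  then have "cov x x \<le> integral\<^sup>L \<mu> (\<lambda>_. 1)" unfolding cov_def by (intro expectation_mono)
  moreover have "0 \<le> cov x x" unfolding cov_def by (intro Bochner_Integration.integral_nonneg) simp
  ultimately show ?thesis by simp
qed

section \<open>Fluctuations of the empirical measure\<close>

lemma empirical_fluctuation_second_moment:
  assumes B: "\<And>x. x \<in> sites N \<Longrightarrow> \<bar>a x\<bar> \<le> B"
  shows "integral\<^sup>L \<mu> (\<lambda>\<eta>. (\<Sum>x\<in>sites N. h x \<eta> * a x)\<^sup>2) \<le> 2 * B\<^sup>2 * real N"
proof -
  have N0: "0 < real N" using N by simp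
  have B0: "0 \<le> B" using B[of 1] boundary_in_sites[of 1] by force
  have "(\<Sum>x\<in>sites N. h x \<eta> * a x)\<^sup>2
      = (\<Sum>x\<in>sites N. \<Sum>y\<in>sites N. a x * a y * (h x \<eta> * h y \<eta>))" for \<eta>
    by (simp add: power2_eq_square sum_product mult_ac)
  then have "integral\<^sup>L \<mu> (\<lambda>\<eta>. (\<Sum>x\<in>sites N. h x \<eta> * a x)\<^sup>2)
      = (\<Sum>x\<in>sites N. \<Sum>y\<in>sites N. a x * a y * cov x y)"
    by (simp add: cov_def Bochner_Integration.integral_sum)
  \<comment> \<open>Diagonal terms are of order 1 and off-diagonal ones of order
    \<open>1 / N\<close>; the former number fewer than \<open>N\<close>, the latter fewer than
    \<open>N^2\<close>, so both totals are of order \<open>N\<close>.\<close>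
  also have "\<dots> \<le> (\<Sum>x\<in>sites N. \<Sum>y\<in>sites N. B\<^sup>2 * (of_bool (x = y) + 1 / real N))"
  proof (intro sum_mono)
    fix x y assume xy: "x \<in> sites N" "y \<in> sites N"
    have "\<bar>cov x y\<bar> \<le> of_bool (x = y) + 1 / real N"
      using cov_bound[OF xy] cov_diagonal_bound[OF xy(1)] N0
      by (cases "x = y") (auto intro: add_increasing2)
    then have "\<bar>a x * a y * cov x y\<bar> \<le> B * B * (of_bool (x = y) + 1 / real N)"
      unfolding abs_mult using B[OF xy(1)] B[OF xy(2)] B0 by (intro mult_mono) auto
    then show "a x * a y * cov x y \<le> B\<^sup>2 * (of_bool (x = y) + 1 / real N)"
      by (simp add: power2_eq_square)
  qed
  also have "\<dots> = B\<^sup>2 * (real (card (sites N)) + (real (card (sites N)))\<^sup>2 / real N)"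
  proof -
    have "(\<Sum>y\<in>sites N. of_bool (x = y)) = (1::real)" if "x \<in> sites N" for x
      using that by (simp add: of_bool_def)
    then show ?thesis
      by (simp add: sum_distrib_left[symmetric] sum.distrib power2_eq_square algebra_simps)
  qed
  also have "\<dots> \<le> B\<^sup>2 * (real N + (real N)\<^sup>2 / real N)"
    using N0 by (intro mult_left_mono add_mono divide_right_mono power_mono) (auto simp: sites_def)
  also have "\<dots> = 2 * B\<^sup>2 * real N" using N0 by (simp add: power2_eq_square)
  finally show ?thesis .
qed

lemma empirical_deviation_bound:
  assumes B: "\<And>t. t \<in> {0..1} \<Longrightarrow> \<bar>H t\<bar> \<le> B"
  shows "integral\<^sup>L \<mu> (\<lambda>\<eta>. \<bar>empirical N \<eta> H - \<gamma> * I\<bar>) \<le>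
    (B\<^sup>2 + 1 / 2) / sqrt (real N) + \<bar>\<gamma>\<bar> * \<bar>1 / real N * (\<Sum>x\<in>sites N. H (real x / real N)) - I\<bar>"
proof -
  have N0: "0 < real N" using N by simp
  \<comment> \<open>The weight in the inequality \<open>2 * s * \<bar>F\<bar> <= F^2 + s^2\<close>
    used below. As the second moment of \<open>F\<close> is of order \<open>N\<close>, this choice
    makes both terms of order \<open>1 / sqrt N\<close> after division by
    \<open>2 * s * N\<close>.\<close>
  define s where "s = sqrt (real N)"
  have s: "0 < s" "s * s = real N" using N0 by (auto simp: s_def)
  define a where "a x = H (real x / real N)" for x
  define F where "F \<eta> = (\<Sum>x\<in>sites N. h x \<eta> * a x)" for \<eta>
  define R where "R = \<bar>\<gamma>\<bar> * \<bar>1 / real N * (\<Sum>x\<in>sites N. H (real x / real N)) - I\<bar>"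
  have "\<bar>empirical N \<eta> H - \<gamma> * I\<bar> \<le> 1 / (2 * s * real N) * (F \<eta>)\<^sup>2 + (1 / (2 * s) + R)" for \<eta>
  proof -
    have "F \<eta> = (\<Sum>x\<in>sites N. real (\<eta> x) * a x) - \<gamma> * (\<Sum>x\<in>sites N. a x)"
      by (simp only: F_def h_def left_diff_distrib sum_subtractf sum_distrib_left)
    then have "empirical N \<eta> H - \<gamma> * I
        = F \<eta> / real N + \<gamma> * (1 / real N * (\<Sum>x\<in>sites N. H (real x / real N)) - I)"
      by (simp add: empirical_def a_def right_diff_distrib diff_divide_distrib)
    then have "\<bar>empirical N \<eta> H - \<gamma> * I\<bar> \<le> \<bar>F \<eta> / real N\<bar> + R"
      unfolding R_def abs_mult[symmetric] by (metis abs_triangle_ineq)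
    then have "\<bar>empirical N \<eta> H - \<gamma> * I\<bar> \<le> \<bar>F \<eta>\<bar> / real N + R" by simp
    moreover have "\<bar>F \<eta>\<bar> / real N \<le> 1 / (2 * s * real N) * (F \<eta>)\<^sup>2 + 1 / (2 * s)"
    proof -
      have "0 \<le> (\<bar>F \<eta>\<bar> - s)\<^sup>2 / (2 * s * real N)" using s N0 by simp
      also have "\<dots> = 1 / (2 * s * real N) * (F \<eta>)\<^sup>2 + 1 / (2 * s) - \<bar>F \<eta>\<bar> / real N"
        using s N0 unfolding s(2)[symmetric] by (simp add: power2_eq_square field_simps)
      finally show ?thesis by simp
    qed
    ultimately show ?thesis by linarith
  qed
  then have "integral\<^sup>L \<mu> (\<lambda>\<eta>. \<bar>empirical N \<eta> H - \<gamma> * I\<bar>)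
      \<le> integral\<^sup>L \<mu> (\<lambda>\<eta>. 1 / (2 * s * real N) * (F \<eta>)\<^sup>2 + (1 / (2 * s) + R))"
    by (intro expectation_mono)
  also have "\<dots> = 1 / (2 * s * real N) * integral\<^sup>L \<mu> (\<lambda>\<eta>. (F \<eta>)\<^sup>2) + (1 / (2 * s) + R)"
    by (subst Bochner_Integration.integral_add) auto
  also have "\<dots> \<le> 1 / (2 * s * real N) * (2 * B\<^sup>2 * real N) + (1 / (2 * s) + R)"
    unfolding F_def using s N0
    by (intro add_right_mono mult_left_mono empirical_fluctuation_second_moment)
      (auto simp: a_def sites_def intro!: B)
  also have "\<dots> = (B\<^sup>2 + 1 / 2) / s + R" using s N0 by (simp add: field_simps)
  finally show ?thesis by (simp add: s_def R_def)
qed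

end

section \<open>Passage to the limit\<close>

theorem theorem2p4:
  fixes \<alpha> \<beta> \<gamma> :: real and H :: "real \<Rightarrow> real"
  assumes "0 < \<alpha>" and "\<alpha> < 1" and "0 < \<beta>" and "\<beta> < 1"
    and "\<gamma> = (\<alpha> + \<beta>) / 2"
    and "continuous_on {0..1} H"
  shows "(\<lambda>N. measure_pmf.expectation (mu_ss \<alpha> \<beta> N)
            (\<lambda>\<eta>. \<bar>empirical N \<eta> H - \<gamma> * integral {0..1} H\<bar>)) \<longlonglongrightarrow> 0"
proof -
  have "compact (H ` {0..1})" using assms(6) by (intro compact_continuous_image) auto
  then have "bounded (H ` {0..1})" by (rule compact_imp_bounded)
  then obtain B where "\<forall>y\<in>H ` {0..1}. norm y \<le> B" unfolding bounded_iff by blast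
  then have B: "\<bar>H t\<bar> \<le> B" if "t \<in> {0..1}" for t using that by auto
  define I where "I = integral {0..1} H"
  define R where "R N = 1 / real N * (\<Sum>x\<in>sites N. H (real x / real N))" for N
  have "R \<longlonglongrightarrow> I"
  proof -
    \<comment> \<open>The Riemann sum starts at \<open>x = 0\<close>, which is not a site; the extra
      term \<open>H 0 / N\<close> tends to zero.\<close>
    have "R N = 1 / real N * (\<Sum>x<N. H (real x / real N)) - 1 / real N * H 0" if "1 \<le> N" for N
    proof -
      have "{..<N} = insert 0 (sites N)" "0 \<notin> sites N" using that by (auto simp: sites_def)
      then show ?thesis by (simp add: R_def distrib_left)
    qed
    then have "\<forall>\<^sub>F N in sequentially.
        1 / real N * (\<Sum>x<N. H (real x / real N)) - 1 / real N * H 0 = R N"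
      by (intro eventually_sequentiallyI[of 1]) simp
    moreover have "(\<lambda>N. 1 / real N * (\<Sum>x<N. H (real x / real N)) - 1 / real N * H 0)
        \<longlonglongrightarrow> I - 0 * H 0"
      unfolding I_def
      by (intro tendsto_diff tendsto_mult tendsto_const riemann_sum_tendsto_integral assms(6)
          lim_1_over_n)
    ultimately show ?thesis by (simp add: Lim_transform_eventually)
  qed
  then have "(\<lambda>N. \<bar>\<gamma>\<bar> * \<bar>R N - I\<bar>) \<longlonglongrightarrow> \<bar>\<gamma>\<bar> * \<bar>I - I\<bar>" by (intro tendsto_intros)
  moreover have "(\<lambda>N. (B\<^sup>2 + 1 / 2) / sqrt (real N)) \<longlonglongrightarrow> 0"
    by (intro real_tendsto_divide_at_top[OF tendsto_const]
        filterlim_compose[OF sqrt_at_top filterlim_real_sequentially])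
  ultimately have lim: "(\<lambda>N. (B\<^sup>2 + 1 / 2) / sqrt (real N) + \<bar>\<gamma>\<bar> * \<bar>R N - I\<bar>) \<longlonglongrightarrow> 0"
    using tendsto_add by fastforce
  have bound: "measure_pmf.expectation (mu_ss \<alpha> \<beta> N) (\<lambda>\<eta>. \<bar>empirical N \<eta> H - \<gamma> * I\<bar>)
      \<le> (B\<^sup>2 + 1 / 2) / sqrt (real N) + \<bar>\<gamma>\<bar> * \<bar>R N - I\<bar>" if "3 \<le> N" for N
  proof -
    interpret exclusion \<alpha> \<beta> N using assms that by unfold_locales auto
    show ?thesis unfolding R_def assms(5) by (rule empirical_deviation_bound[OF B])
  qed
  show ?thesis
    unfolding I_def[symmetric]
  proof (rule tendsto_sandwich[OF _ _ tendsto_const lim])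
    show "\<forall>\<^sub>F N in sequentially.
        0 \<le> measure_pmf.expectation (mu_ss \<alpha> \<beta> N) (\<lambda>\<eta>. \<bar>empirical N \<eta> H - \<gamma> * I\<bar>)"
      by (intro always_eventually allI Bochner_Integration.integral_nonneg) simp
    show "\<forall>\<^sub>F N in sequentially. measure_pmf.expectation (mu_ss \<alpha> \<beta> N)
        (\<lambda>\<eta>. \<bar>empirical N \<eta> H - \<gamma> * I\<bar>) \<le> (B\<^sup>2 + 1 / 2) / sqrt (real N) + \<bar>\<gamma>\<bar> * \<bar>R N - I\<bar>"
      using bound by (rule eventually_sequentiallyI[of 3])
  qed
qed

end
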